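(* Let $a,z$ be indeterminates and work over $\mathbb{Q}(a,z)$. Let $g(x)\in\mathbb{Q}(a,z)[[x]]$ with $g(0)=0$ be defined by $$g(x)=x(a-1)\big(1+g(x)\big)^{\frac{a}{a-1}},$$ and let $f(x)=\big(1+g(x)\big)^{\frac{za}{a-1}}$. Define $$\rho(n)=\frac{\prod_{i=1}^{n-1}\big(an-(a-1)i\big)}{n\prod_{i=1}^{n-2}\big(a(n-1+z)-(a-1)i\big)}.$$ Then $1+\sum_{n\ge1}\Big(\sum_{F\in F(n)}\prod_{h\in\mathcal{H}(F)}\rho(h)\Big)\frac{x^n}{n!}=f(x)$, i.e. for every $n\ge1$, $$\sum_{F\in F(n)}\prod_{h\in\mathcal{H}(F)}\frac{\prod_{i=1}^{h-1}\big(ah-(a-1)i\big)}{h\prod_{i=1}^{h-2}\big(a(h-1+z)-(a-1)i\big)}=za\prod_{i=1}^{n-1}\big(a(n+z)-(a-1)i\big).$$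
   Context: $F(n)$ is the set of labeled forests on $\{1,\dots,n\}$, i.e. sets of rooted labeled trees (children unordered) whose vertex sets partition $\{1,\dots,n\}$. For a vertex $u$ of $F$, the hook length $h_u$ is the number of descendants of $u$ (counting $u$ itself), and $\mathcal{H}(F)$ is the multiset of hook lengths of all vertices; the product is over all vertices. For a power series $g$ with $g(0)=0$, $(1+g)^r=\sum_{j\ge0}\binom{r}{j}g^j$. Product convention: $\prod_{i=1}^{m}c_i$ is the ordinary product for $m\ge1$, equals $1$ for $m=0$, and for $m=-1$ equals $1/c_0$ where $c_0$ is the factor evaluated at $i=0$ (so for $h=1$, $\prod_{i=1}^{-1}(a(h-1+z)-(a-1)i)=1/(za)$). *)

theory Defs
  imports
    "HOL-Library.FSet"
    "HOL-Library.Multiset"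
    "HOL-Library.Disjoint_Sets"
    "HOL-Computational_Algebra.Computational_Algebra"
begin

section \<open>Labeled forests and hook lengths\<close>

text \<open>
  Rooted trees with unordered children.  Since the children form a finite set rather than a
  multiset, this is only meant for trees whose vertices carry distinct labels; that is what
  \<open>labeled_tree\<close> demands.
\<close>

datatype (verts: 'a) rtree = Node (root: 'a) (children: "'a rtree fset")

inductive labeled_tree :: "'a rtree \<Rightarrow> bool" where
  "\<lbrakk>\<forall>t\<in>fset ts. labeled_tree t; \<forall>t\<in>fset ts. r \<notin> verts t; disjoint_family_on verts (fset ts)\<rbrakk>
     \<Longrightarrow> labeled_tree (Node r ts)"

definition labeled_forests :: "nat \<Rightarrow> nat rtree set set" where
  "labeled_forests n =
     {F. (\<forall>T\<in>F. labeled_tree T) \<and> disjoint_family_on verts F \<and> (\<Union>T\<in>F. verts T) = {1..n}}"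

text \<open>All full subtrees of a forest, one for each of its vertices.\<close>

inductive_set subtrees :: "'a rtree set \<Rightarrow> 'a rtree set" for F :: "'a rtree set" where
  tree: "T \<in> F \<Longrightarrow> T \<in> subtrees F"
| child: "\<lbrakk>T \<in> subtrees F; t \<in> fset (children T)\<rbrakk> \<Longrightarrow> t \<in> subtrees F"

text \<open>The descendants of \<open>u\<close>, including \<open>u\<close>, are the vertices of the subtree rooted at \<open>u\<close>.\<close>

definition descendants :: "'a rtree set \<Rightarrow> 'a \<Rightarrow> 'a set" where
  "descendants F u = (\<Union>T\<in>{T \<in> subtrees F. root T = u}. verts T)"

definition hook_length :: "'a rtree set \<Rightarrow> 'a \<Rightarrow> nat" where
  "hook_length F u = card (descendants F u)"

definition hook_lengths :: "'a rtree set \<Rightarrow> nat multiset" where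
  "hook_lengths F = image_mset (hook_length F) (mset_set (\<Union>T\<in>F. verts T))"

section \<open>The weight\<close>

text \<open>
  The product of \<open>c i\<close> over \<open>i = 1, \<dots>, m\<close>, with the convention that it is \<open>1 / c 0\<close> for \<open>m = -1\<close>.
  Values \<open>m < -1\<close> are never used.
\<close>

definition ext_prod :: "int \<Rightarrow> (int \<Rightarrow> 'a::field) \<Rightarrow> 'a" where
  "ext_prod m c = (if m = -1 then 1 / c 0 else (\<Prod>i=1..m. c i))"

definition rho :: "'a::field \<Rightarrow> 'a \<Rightarrow> nat \<Rightarrow> 'a" where
  "rho a z n =
     ext_prod (int n - 1) (\<lambda>i. a * of_nat n - (a - 1) * of_int i) /
     (of_nat n * ext_prod (int n - 2) (\<lambda>i. a * (of_nat n - 1 + z) - (a - 1) * of_int i))"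

section \<open>Powers of power series\<close>

text \<open>
  \<open>one_plus_power g r\<close> is \<open>(1 + g)\<^sup>r\<close>, the sum of \<open>(r gchoose j) * g ^ j\<close> over all \<open>j\<close>.
  It is only meaningful if \<open>g\<close> has zero constant term.
\<close>

definition one_plus_power :: "'a::field_char_0 fps \<Rightarrow> 'a \<Rightarrow> 'a fps" where
  "one_plus_power g r = fps_binomial r oo g"

text \<open>
  The functional equation \<open>g = c x (1 + g)\<^sup>r\<close> does define a series; the solution is the
  compositional inverse of \<open>x / (c (1 + x)\<^sup>r)\<close>.
\<close>

lemma functional_equation_ex1:
  fixes c r :: "'a::field_char_0"
  assumes c: "c \<noteq> 0"
  shows "\<exists>!g. fps_nth g 0 = 0 \<and> g = fps_X * fps_const c * one_plus_power g r"
proof -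
  define p where "p = fps_const c * fps_binomial r"
  define h where "h = fps_X * inverse p"
  have p0: "fps_nth p 0 \<noteq> 0" using c by (simp add: p_def)
  have h0: "fps_nth h 0 = 0" by (simp add: h_def)
  have h1: "fps_nth h 1 \<noteq> 0" using p0 by (simp add: h_def)
  have iff: "g = fps_X * fps_const c * one_plus_power g r \<longleftrightarrow> h oo g = fps_X"
    if g0: "fps_nth g 0 = 0" for g
  proof -
    have pg: "p oo g = fps_const c * one_plus_power g r"
      by (simp add: p_def one_plus_power_def fps_compose_mult_distrib[OF g0])
    have "h oo g = g * inverse (p oo g)"
      by (simp add: h_def fps_compose_mult_distrib[OF g0] fps_inverse_compose[OF g0 p0] g0)
    moreover have inv: "inverse (p oo g) * (p oo g) = 1"
      using p0 by (intro inverse_mult_eq_1) simp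
    have "g * inverse (p oo g) = fps_X \<longleftrightarrow> g = fps_X * (p oo g)"
    proof
      assume "g * inverse (p oo g) = fps_X"
      then have "fps_X * (p oo g) = g * (inverse (p oo g) * (p oo g))"
        by (metis mult.assoc)
      then show "g = fps_X * (p oo g)" by (simp add: inv)
    next
      assume "g = fps_X * (p oo g)"
      then have "g * inverse (p oo g) = fps_X * (inverse (p oo g) * (p oo g))"
        by (metis mult.assoc mult.commute)
      then show "g * inverse (p oo g) = fps_X" by (simp add: inv)
    qed
    ultimately have "h oo g = fps_X \<longleftrightarrow> g = fps_X * (p oo g)" by simp
    then show ?thesis by (simp add: pg mult.assoc)
  qed
  show ?thesis
  proof (rule ex1I[of _ "fps_inv h"])
    have "fps_nth (fps_inv h) 0 = 0" by (simp add: fps_inv_def)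
    then show "fps_nth (fps_inv h) 0 = 0 \<and>
        fps_inv h = fps_X * fps_const c * one_plus_power (fps_inv h) r"
      using iff fps_inv_right[OF h0 h1] by blast
  next
    fix g assume g: "fps_nth g 0 = 0 \<and> g = fps_X * fps_const c * one_plus_power g r"
    then have "h oo g = fps_X" using iff by blast
    then have "fps_inv h = fps_inv h oo (h oo g)" by simp
    also have "\<dots> = (fps_inv h oo h) oo g"
      using fps_compose_assoc g h0 by blast
    also have "\<dots> = g" using fps_inv[OF h0 h1] g by simp
    finally show "g = fps_inv h" by simp
  qed
qed

end

theory Submission
  imports Defs
begin

text \<open>
  Let \<open>S n\<close> be the weighted number of forests on \<open>n\<close> labels and \<open>T n\<close> that of trees.  Removing the
  root of a tree gives \<open>T (n + 1) = (n + 1) * rho (n + 1) * S n\<close>, and splitting off the tree that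
  contains a fixed label gives \<open>S (n + 1) = (\<Sum>k\<le>n. (n choose k) * T (k + 1) * S (n - k))\<close>.  These two
  recurrences determine \<open>S\<close>.  The second one is the identity \<open>f' = (f' / f) * f\<close> read off at
  coefficients, so it remains to see that \<open>T (k + 1) / k!\<close> are the coefficients of
  \<open>f' / f = z * a / (a - 1) * g' / (1 + g)\<close>.  The coefficients of \<open>(1 + g)\<^sup>s\<close> are found without Lagrange
  inversion: differentiating \<open>g = c x (1 + g)\<^sup>r\<close> expresses the derivative of \<open>(1 + g)\<^sup>s\<close> through
  \<open>(1 + g)\<^sup>u\<close> with \<open>u = s + r - 1\<close>, which lowers the degree by one while shifting the exponent.
\<close>

section \<open>Powers of the solution of the functional equation\<close>

lemma one_plus_power_nth_0 [simp]: "fps_nth (one_plus_power g s) 0 = 1"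
  by (simp add: one_plus_power_def)

lemma one_plus_power_add:
  assumes "fps_nth g 0 = 0"
  shows "one_plus_power g (s + t) = one_plus_power g s * one_plus_power g t"
  using assms by (simp add: one_plus_power_def fps_binomial_add_mult fps_compose_mult_distrib)

lemma fps_deriv_fps_binomial:
  fixes s :: "'a::field_char_0"
  shows "fps_deriv (fps_binomial s) = fps_const s * fps_binomial (s - 1)"
proof (rule fps_ext)
  fix n
  have "of_nat (Suc n) * (s gchoose Suc n) = s * ((s - 1) gchoose n)"
    using gbinomial_absorption'[of "Suc n" s] by (simp add: field_simps del: of_nat_Suc)
  then show "fps_nth (fps_deriv (fps_binomial s)) n =
      fps_nth (fps_const s * fps_binomial (s - 1)) n"
    by simp
qed

lemma fps_deriv_one_plus_power:
  assumes "fps_nth g 0 = 0"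
  shows "fps_deriv (one_plus_power g s) = fps_const s * one_plus_power g (s - 1) * fps_deriv g"
  using assms
  by (simp add: one_plus_power_def fps_compose_deriv fps_deriv_fps_binomial
      fps_compose_mult_distrib)

text \<open>Differentiating the equation gives
  \<open>g' = c (1 + g)^r + c r x (1 + g)^(r - 1) g'\<close>. After multiplication by
  \<open>(1 + g)^(u - r)\<close> the last term contains \<open>(1 + g)^(u - 1) g'\<close>, which is
  \<open>1 / u\<close> times the derivative of \<open>(1 + g)^u\<close>; and \<open>x d/dx\<close>
  multiplies the \<open>n\<close>-th coefficient by \<open>n\<close>.\<close>

lemma fps_deriv_solution_mult_nth:
  fixes g :: "'a::field_char_0 fps"
  assumes g0: "fps_nth g 0 = 0"
    and g: "g = fps_X * fps_const c * one_plus_power g r"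
    and u: "u \<noteq> 0"
  shows "fps_nth (fps_deriv g * one_plus_power g (u - r)) n =
    c * (1 + r * of_nat n / u) * fps_nth (one_plus_power g u) n"
proof -
  let ?B = "one_plus_power g"
  have "fps_deriv g = fps_const c * ?B r + fps_X * fps_const c * fps_deriv (?B r)"
    by (subst g) (simp add: algebra_simps)
  then have g': "fps_deriv g =
      fps_const c * ?B r + fps_X * fps_const (c * r) * ?B (r - 1) * fps_deriv g"
    by (simp add: fps_deriv_one_plus_power[OF g0] mult_ac flip: fps_const_mult)
  have B1: "?B r * ?B (u - r) = ?B u"
    by (simp flip: one_plus_power_add[OF g0])
  have B2: "?B (r - 1) * ?B (u - r) = ?B (u - 1)"
    by (simp flip: one_plus_power_add[OF g0])
  have "fps_deriv g * ?B (u - r) =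
      fps_const c * (?B r * ?B (u - r)) +
      fps_X * (fps_const (c * r) * (?B (r - 1) * ?B (u - r)) * fps_deriv g)"
    by (subst g') (simp add: algebra_simps)
  also have "\<dots> = fps_const c * ?B u + fps_X * (fps_const (c * r / u) * fps_deriv (?B u))"
    unfolding B1 B2 using u
    by (simp add: fps_deriv_one_plus_power[OF g0] flip: mult.assoc)
  also have "fps_nth \<dots> n = c * (1 + r * of_nat n / u) * fps_nth (?B u) n"
    by (cases n) (simp_all add: algebra_simps add_divide_distrib)
  finally show ?thesis .
qed

text \<open>In Lagrange form, with \<open>N = n + 1\<close>, the coefficient is
  \<open>s / N * c^N * binom(s + r * N - 1, N - 1)\<close>. Each induction step lowers the degree by
  one and moves the exponent by \<open>r - 1\<close>; the hypothesis keeps the exponents that become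
  denominators nonzero.\<close>

lemma one_plus_power_solution_nth_Suc:
  fixes g :: "'a::field_char_0 fps"
  assumes g0: "fps_nth g 0 = 0"
    and g: "g = fps_X * fps_const c * one_plus_power g r"
    and "\<And>k. s + of_nat (Suc k) * (r - 1) \<noteq> 0"
  shows "fact (Suc n) * fps_nth (one_plus_power g s) (Suc n) =
    c ^ Suc n * s * (\<Prod>i<n. s + r * of_nat (Suc n) - of_nat (Suc i))"
  using assms(3)
proof (induction n arbitrary: s)
  case (0 s)
  have "s - 1 + r \<noteq> 0" using 0[of 0] by (simp add: algebra_simps)
  from fps_deriv_solution_mult_nth[OF g0 g this, of 0]
  have "fps_nth (fps_deriv g * one_plus_power g (s - 1)) 0 = c" by simp
  moreover have "fps_nth (one_plus_power g s) 1 = fps_nth (fps_deriv (one_plus_power g s)) 0"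
    by simp
  ultimately show ?case by (simp add: fps_deriv_one_plus_power[OF g0])
next
  case (Suc n s)
  let ?B = "one_plus_power g"
  \<comment> \<open>Then \<open>s - 1 = u - r\<close>, so the derivative of \<open>(1 + g)^s\<close>
    has the form treated by the previous lemma.\<close>
  define u where "u = s - 1 + r"
  have u: "u \<noteq> 0" using Suc.prems[of 0] by (simp add: u_def algebra_simps)
  have uk: "u + of_nat (Suc k) * (r - 1) \<noteq> 0" for k
    using Suc.prems[of "Suc k"] by (simp add: u_def algebra_simps)
  have "of_nat (Suc (Suc n)) * fps_nth (?B s) (Suc (Suc n)) = fps_nth (fps_deriv (?B s)) (Suc n)"
    by simp
  also have "\<dots> = s * fps_nth (fps_deriv g * ?B (u - r)) (Suc n)"
    by (simp add: fps_deriv_one_plus_power[OF g0] u_def mult_ac)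
  also have "\<dots> = s * (c * (1 + r * of_nat (Suc n) / u) * fps_nth (?B u) (Suc n))"
    by (simp only: fps_deriv_solution_mult_nth[OF g0 g u])
  finally have "fact (Suc (Suc n)) * fps_nth (?B s) (Suc (Suc n)) =
      s * (c * (1 + r * of_nat (Suc n) / u) * (fact (Suc n) * fps_nth (?B u) (Suc n)))"
    by (simp add: fact_Suc[of "Suc n"] mult_ac del: fact_Suc of_nat_Suc)
  also have "\<dots> = s * (c * (1 + r * of_nat (Suc n) / u) *
      (c ^ Suc n * u * (\<Prod>i<n. u + r * of_nat (Suc n) - of_nat (Suc i))))"
    by (simp only: Suc.IH[OF uk])
  \<comment> \<open>The factor \<open>u\<close> supplied by the induction hypothesis clears the
    denominator.\<close>
  also have "\<dots> = c ^ Suc (Suc n) * s * ((u + r * of_nat (Suc n)) *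
      (\<Prod>i<n. u + r * of_nat (Suc n) - of_nat (Suc i)))"
    using u by (simp add: field_simps del: of_nat_Suc)
  \<comment> \<open>Since \<open>u = s + r - 1\<close>, the new factor is the one for
    \<open>i = 0\<close>, and the old factors move up by one index.\<close>
  also have "(u + r * of_nat (Suc n)) * (\<Prod>i<n. u + r * of_nat (Suc n) - of_nat (Suc i)) =
      (\<Prod>i<Suc n. s + r * of_nat (Suc (Suc n)) - of_nat (Suc i))"
    by (subst prod.lessThan_Suc_shift) (simp add: u_def algebra_simps)
  finally show ?case .
qed

text \<open>Here \<open>r - 1 = 1 / (a - 1)\<close>, so the exponents met are
  \<open>(t + k) / (a - 1)\<close> with \<open>k\<close> positive. Of the powers of
  \<open>c = a - 1\<close>, one turns \<open>s\<close> into \<open>t\<close> and the others clear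
  the denominators of the factors.\<close>

lemma one_plus_power_solution_scaled_nth:
  fixes a t :: "'a::field_char_0"
  assumes g0: "fps_nth g 0 = 0"
    and g: "g = fps_X * fps_const (a - 1) * one_plus_power g (a / (a - 1))"
    and a: "a \<noteq> 1"
    and t: "\<And>k. t + of_nat (Suc k) \<noteq> 0"
  shows "fact (Suc n) * fps_nth (one_plus_power g (t / (a - 1))) (Suc n) =
    t * (\<Prod>i<n. a * of_nat (Suc n) + t - (a - 1) * of_nat (Suc i))"
proof -
  have r1: "a / (a - 1) - 1 = 1 / (a - 1)"
    using a by (simp add: field_simps)
  have "t / (a - 1) + of_nat (Suc k) * (a / (a - 1) - 1) \<noteq> 0" for k
    unfolding r1 using a t[of k] by (simp add: divide_simps)
  from one_plus_power_solution_nth_Suc[OF g0 g this, of n]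
  have "fact (Suc n) * fps_nth (one_plus_power g (t / (a - 1))) (Suc n) =
      t * ((a - 1) ^ n *
        (\<Prod>i<n. t / (a - 1) + a / (a - 1) * of_nat (Suc n) - of_nat (Suc i)))"
    using a by simp
  also have "(a - 1) ^ n *
        (\<Prod>i<n. t / (a - 1) + a / (a - 1) * of_nat (Suc n) - of_nat (Suc i)) =
      (\<Prod>i<n. (a - 1) * (t / (a - 1) + a / (a - 1) * of_nat (Suc n) - of_nat (Suc i)))"
    by (simp add: prod.distrib)
  also have "\<dots> = (\<Prod>i<n. a * of_nat (Suc n) + t - (a - 1) * of_nat (Suc i))"
  proof -
    have "b * (t / b + a / b * x - y) = a * x + t - b * y" if "b \<noteq> 0" for b x y :: 'a
      using that by (simp add: field_simps)
    then show ?thesis using a by (intro prod.cong) simp_all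
  qed
  finally show ?thesis .
qed

text \<open>The series is the derivative of \<open>log (1 + g)\<close>. The exponent
  \<open>u - r = -1\<close> forces \<open>u = 1 / (a - 1)\<close>, that is \<open>t = 1\<close> in
  the scaled formula.\<close>

lemma log_deriv_solution_nth:
  fixes a :: "'a::field_char_0"
  assumes g0: "fps_nth g 0 = 0"
    and g: "g = fps_X * fps_const (a - 1) * one_plus_power g (a / (a - 1))"
    and a: "a \<noteq> 1"
  shows "fact n * fps_nth (fps_deriv g * one_plus_power g (-1)) n =
    (a - 1) * (\<Prod>i<n. a * of_nat (Suc n) - (a - 1) * of_nat (Suc i))"
proof -
  let ?B = "one_plus_power g"
  define u where "u = 1 / (a - 1)"
  have u: "u \<noteq> 0" and ur: "u - a / (a - 1) = -1" and au: "a / (a - 1) * of_nat n / u = a * of_nat n"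
    using a by (simp_all add: u_def field_simps)
  from fps_deriv_solution_mult_nth[OF g0 g u, of n]
  have *: "fps_nth (fps_deriv g * ?B (-1)) n = (a - 1) * (1 + a * of_nat n) * fps_nth (?B u) n"
    unfolding ur au by simp
  show ?thesis
  \<comment> \<open>The scaled formula covers positive degrees only; in degree 0 the coefficient of
    \<open>(1 + g)^u\<close> is 1.\<close>
  proof (cases n)
    case 0
    then show ?thesis using * by simp
  next
    case (Suc m)
    have nz: "(1 :: 'a) + of_nat (Suc k) \<noteq> 0" for k
      by (metis of_nat_Suc of_nat_eq_0_iff nat.distinct(1))
    have "fact n * fps_nth (fps_deriv g * ?B (-1)) n =
        (a - 1) * (1 + a * of_nat n) * (fact (Suc m) * fps_nth (?B u) (Suc m))"
      unfolding * by (simp add: Suc mult_ac del: fact_Suc)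
    also have "\<dots> = (a - 1) * ((1 + a * of_nat n) *
        (\<Prod>i<m. a * of_nat (Suc m) + 1 - (a - 1) * of_nat (Suc i)))"
      unfolding u_def one_plus_power_solution_scaled_nth[OF g0 g a nz] by simp
    \<comment> \<open>\<open>1 + a * n\<close> is \<open>a * (n + 1) - (a - 1)\<close>, the factor
      for \<open>i = 0\<close>.\<close>
    also have "(1 + a * of_nat n) *
          (\<Prod>i<m. a * of_nat (Suc m) + 1 - (a - 1) * of_nat (Suc i)) =
        (\<Prod>i<n. a * of_nat (Suc n) - (a - 1) * of_nat (Suc i))"
      unfolding Suc by (subst prod.lessThan_Suc_shift) (simp add: algebra_simps)
    finally show ?thesis .
  qed
qed

lemma one_plus_power_nth_Suc_convolution:
  fixes g :: "'a::field_char_0 fps"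
  assumes g0: "fps_nth g 0 = 0"
  shows "fact (Suc n) * fps_nth (one_plus_power g s) (Suc n) =
    (\<Sum>k\<le>n. of_nat (n choose k) *
      (s * (fact k * fps_nth (fps_deriv g * one_plus_power g (-1)) k)) *
      (fact (n - k) * fps_nth (one_plus_power g s) (n - k)))"
proof -
  let ?B = "one_plus_power g" and ?L = "fps_deriv g * one_plus_power g (-1)"
  have "?B (s - 1) = ?B (-1) * ?B s"
    by (simp flip: one_plus_power_add[OF g0])
  then have "fps_deriv (?B s) = fps_const s * (?L * ?B s)"
    by (simp add: fps_deriv_one_plus_power[OF g0] mult_ac)
  then have "of_nat (Suc n) * fps_nth (?B s) (Suc n) = s * fps_nth (?L * ?B s) n"
    by (metis fps_deriv_nth fps_mult_left_const_nth Suc_eq_plus1)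
  then have "fact (Suc n) * fps_nth (?B s) (Suc n) = fact n * (s * fps_nth (?L * ?B s) n)"
    by (simp add: mult_ac)
  also have "\<dots> = (\<Sum>k\<le>n. fact n * (s * (fps_nth ?L k * fps_nth (?B s) (n - k))))"
    by (simp add: fps_mult_nth[of ?L] sum_distrib_left atMost_atLeast0 del: fps_mult_nth)
  also have "\<dots> = (\<Sum>k\<le>n. of_nat (n choose k) * (s * (fact k * fps_nth ?L k)) *
      (fact (n - k) * fps_nth (?B s) (n - k)))"
  proof (rule sum.cong)
    fix k assume "k \<in> {..n}"
    then have "(fact n :: 'a) = of_nat (fact k * fact (n - k) * (n choose k))"
      by (subst binomial_fact_lemma) simp_all
    then show "fact n * (s * (fps_nth ?L k * fps_nth (?B s) (n - k))) =
        of_nat (n choose k) * (s * (fact k * fps_nth ?L k)) *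
        (fact (n - k) * fps_nth (?B s) (n - k))"
      by (simp add: mult_ac)
  qed simp
  finally show ?thesis .
qed

section \<open>Decomposing labeled forests\<close>

text \<open>Arbitrary label sets are allowed, so that cutting off a root or a tree leaves an object
  of the same kind without relabeling.\<close>

definition trees_on :: "'a set \<Rightarrow> 'a rtree set" where
  "trees_on A = {T. labeled_tree T \<and> verts T = A}"

definition forests_on :: "'a set \<Rightarrow> 'a rtree set set" where
  "forests_on A =
     {F. (\<forall>T\<in>F. labeled_tree T) \<and> disjoint_family_on verts F \<and> (\<Union>T\<in>F. verts T) = A}"

lemma root_in_verts [simp]: "root T \<in> verts T"
  by (cases T) simp

lemma labeled_tree_Node:
  "labeled_tree (Node r ts) \<longleftrightarrow>
    r \<notin> (\<Union>T\<in>fset ts. verts T) \<and> fset ts \<in> forests_on (\<Union>T\<in>fset ts. verts T)"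
  by (subst labeled_tree.simps) (auto simp: forests_on_def)

text \<open>Disjoint nonempty vertex sets determine their trees, so a forest embeds into the power
  set of its labels. Finiteness lets \<open>Abs_fset\<close> turn a forest into the children of a
  node.\<close>

lemma finite_forest:
  assumes "finite A" "F \<in> forests_on A"
  shows "finite F"
proof (rule inj_on_finite)
  show "inj_on verts F"
  proof (rule inj_onI)
    fix T T' assume *: "T \<in> F" "T' \<in> F" "verts T = verts T'"
    show "T = T'"
    proof (rule ccontr)
      assume "T \<noteq> T'"
      moreover have "disjoint_family_on verts F" using assms by (simp add: forests_on_def)
      ultimately have "verts T \<inter> verts T' = {}"
        using * unfolding disjoint_family_on_def by blast
      then show False using * root_in_verts[of T] by auto
    qed
  qed
  show "verts ` F \<subseteq> Pow A" using assms by (auto simp: forests_on_def)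
  show "finite (Pow A)" using assms by simp
qed

lemma forests_on_empty: "forests_on {} = {{}}"
proof -
  have "verts T \<noteq> {}" for T :: "'a rtree"
    using root_in_verts[of T] by blast
  then show ?thesis by (auto simp: forests_on_def disjoint_family_on_def)
qed

lemma bij_betw_trees_on:
  assumes "finite A"
  shows "bij_betw (\<lambda>(r, F). Node r (Abs_fset F)) (SIGMA r:A. forests_on (A - {r})) (trees_on A)"
proof (rule bij_betwI[where g = "\<lambda>T. (root T, fset (children T))"])
  have fin: "finite F" if "F \<in> forests_on (A - {r})" for r F
    using finite_forest[OF _ that] assms by simp
  show "(\<lambda>(r, F). Node r (Abs_fset F)) \<in> (SIGMA r:A. forests_on (A - {r})) \<rightarrow> trees_on A"
  proof safe
    fix r F assume *: "r \<in> A" "F \<in> forests_on (A - {r})"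
    then have "(\<Union>T\<in>F. verts T) = A - {r}" by (simp add: forests_on_def)
    with * fin[OF *(2)] show "Node r (Abs_fset F) \<in> trees_on A"
      by (auto simp: trees_on_def labeled_tree_Node Abs_fset_inverse)
  qed
  show "(\<lambda>T. (root T, fset (children T))) \<in> trees_on A \<rightarrow> (SIGMA r:A. forests_on (A - {r}))"
  proof
    fix T assume T: "T \<in> trees_on A"
    obtain r ts where Node: "T = Node r ts" by (cases T)
    with T have "r \<notin> (\<Union>T\<in>fset ts. verts T)" "fset ts \<in> forests_on (\<Union>T\<in>fset ts. verts T)"
      "insert r (\<Union>T\<in>fset ts. verts T) = A"
      by (auto simp: trees_on_def labeled_tree_Node)
    moreover from this have "(\<Union>T\<in>fset ts. verts T) = A - {r}" by blast
    ultimately show "(root T, fset (children T)) \<in> (SIGMA r:A. forests_on (A - {r}))"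
      using Node by auto
  qed
  show "(\<lambda>T. (root T, fset (children T))) ((\<lambda>(r, F). Node r (Abs_fset F)) p) = p"
    if "p \<in> (SIGMA r:A. forests_on (A - {r}))" for p
    using that fin by (auto simp: Abs_fset_inverse)
  show "(\<lambda>(r, F). Node r (Abs_fset F)) ((\<lambda>T. (root T, fset (children T))) T) = T" for T
    by (cases T) (simp add: fset_inverse)
qed

text \<open>Exactly one tree of a forest contains the marked label \<open>m\<close>. It is split
  off, and \<open>B\<close> records its other vertices.\<close>

lemma bij_betw_forests_on:
  assumes m: "m \<in> A"
  shows "bij_betw (\<lambda>(B, T, F). insert T F)
    (SIGMA B:Pow (A - {m}). trees_on (insert m B) \<times> forests_on (A - insert m B)) (forests_on A)"
  (is "bij_betw ?f ?S _")
  unfolding bij_betw_def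
proof
  show "inj_on ?f ?S"
  proof (rule inj_onI)
    fix p p' assume p: "p \<in> ?S" "p' \<in> ?S" "?f p = ?f p'"
    obtain B T F B' T' F' where pp': "p = (B, T, F)" "p' = (B', T', F')"
      by (cases p, cases p')
    with p have B: "B \<subseteq> A - {m}" "T \<in> trees_on (insert m B)" "F \<in> forests_on (A - insert m B)"
      and B': "B' \<subseteq> A - {m}" "T' \<in> trees_on (insert m B')" "F' \<in> forests_on (A - insert m B')"
      and eq: "insert T F = insert T' F'"
      by simp_all
    \<comment> \<open>The label \<open>m\<close> lies in \<open>T\<close> but in no tree of
      \<open>F\<close>, so \<open>T\<close> can be recognized inside
      \<open>insert T F\<close>.\<close>
    have "m \<notin> (\<Union>t\<in>F. verts t)" "m \<notin> (\<Union>t\<in>F'. verts t)"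
      using B B' by (simp_all add: forests_on_def)
    then have m: "\<forall>t\<in>F. m \<notin> verts t" "\<forall>t\<in>F'. m \<notin> verts t" "m \<in> verts T" "m \<in> verts T'"
      using B B' by (simp_all add: trees_on_def)
    then have T: "T = T'" using eq by blast
    have "F = insert T F - {T}" "F' = insert T' F' - {T'}" using m by blast+
    then have F: "F = F'" using eq T by metis
    have "insert m B = insert m B'" using B B' T by (simp add: trees_on_def)
    then have "B = B'" using B(1) B'(1) by blast
    then show "p = p'" using T F pp' by simp
  qed
  show "?f ` ?S = forests_on A"
  proof (intro equalityI subsetI)
    fix G assume "G \<in> ?f ` ?S"
    then obtain B T F where G: "G = insert T F" and B: "B \<subseteq> A - {m}"
      and T: "labeled_tree T" "verts T = insert m B"
      and F: "\<forall>t\<in>F. labeled_tree t" "disjoint_family_on verts F"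
        "(\<Union>t\<in>F. verts t) = A - insert m B"
      by (auto simp: trees_on_def forests_on_def)
    have "verts T \<inter> verts t = {}" if "t \<in> F" for t
      using that T F by blast
    then have "disjoint_family_on verts G"
      using F(2) by (auto simp: G disjoint_family_on_def)
    then show "G \<in> forests_on A"
      using T F B m by (auto simp: forests_on_def G)
  next
    fix G assume G: "G \<in> forests_on A"
    then obtain T where T: "T \<in> G" "m \<in> verts T" using m by (auto simp: forests_on_def)
    define B where "B = verts T - {m}"
    have vT: "verts T = insert m B" using T by (auto simp: B_def)
    have dis: "verts T \<inter> verts t = {}" if "t \<in> G - {T}" for t
      using that G T by (auto simp: forests_on_def disjoint_family_on_def)
    have un: "(\<Union>t\<in>G. verts t) = A" using G by (simp add: forests_on_def)
    have "(\<Union>t\<in>G - {T}. verts t) = A - insert m B"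
      using un dis T unfolding vT[symmetric] by fast
    then have "G - {T} \<in> forests_on (A - insert m B)"
      using G by (auto simp: forests_on_def disjoint_family_on_def)
    moreover have "T \<in> trees_on (insert m B)"
      using G T vT by (auto simp: trees_on_def forests_on_def)
    moreover have "B \<subseteq> A - {m}" using un T by (auto simp: B_def)
    ultimately have "(B, T, G - {T}) \<in> ?S" by auto
    moreover have "?f (B, T, G - {T}) = G" using T by auto
    ultimately show "G \<in> ?f ` ?S" by (intro image_eqI[OF sym])
  qed
qed

section \<open>Finiteness of the sets of trees and forests\<close>

lemma finite_trees_on:
  assumes "finite A" "\<And>r. r \<in> A \<Longrightarrow> finite (forests_on (A - {r}))"
  shows "finite (trees_on A)"
  using bij_betw_finite[OF bij_betw_trees_on[OF assms(1)]] assms by auto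

lemma finite_forests_on: "finite A \<Longrightarrow> finite (forests_on A)"
proof (induction A rule: finite_psubset_induct)
  case (psubset A)
  show ?case
  proof (cases "A = {}")
    case True
    then show ?thesis by (simp add: forests_on_empty)
  next
    case False
    then obtain m where m: "m \<in> A" by blast
    \<comment> \<open>\<open>insert m B\<close> may be all of \<open>A\<close>, but deleting a root
      leaves a proper subset, so the induction hypothesis applies to the forests below the
      root.\<close>
    have "finite (trees_on (insert m B))" if "B \<subseteq> A - {m}" for B
    proof (rule finite_trees_on)
      show "finite (insert m B)" using that psubset.hyps finite_subset by fastforce
      show "finite (forests_on (insert m B - {r}))" if "r \<in> insert m B" for r
        using that \<open>B \<subseteq> A - {m}\<close> m by (intro psubset.IH) blast
    qed
    moreover have "finite (forests_on (A - insert m B))" for B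
      using m by (intro psubset.IH) blast
    ultimately have "finite (SIGMA B:Pow (A - {m}).
        trees_on (insert m B) \<times> forests_on (A - insert m B))"
      using psubset.hyps by (intro finite_SigmaI finite_cartesian_product) auto
    then show ?thesis using bij_betw_finite[OF bij_betw_forests_on[OF m]] by blast
  qed
qed

section \<open>Hook weights\<close>

lemma verts_subtrees: "T \<in> subtrees F \<Longrightarrow> verts T \<subseteq> (\<Union>T\<in>F. verts T)"
proof (induction rule: subtrees.induct)
  case (child T t)
  obtain r ts where "T = Node r ts" by (cases T)
  with child show ?case by auto
qed blast

lemma subtrees_Un: "subtrees (F \<union> G) = subtrees F \<union> subtrees G"
proof (intro equalityI subsetI)
  fix T assume "T \<in> subtrees (F \<union> G)"
  then show "T \<in> subtrees F \<union> subtrees G"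
    by induction (auto intro: subtrees.intros)
next
  have "T \<in> subtrees (F \<union> G)" if "T \<in> subtrees F" for T and F G :: "'a rtree set"
    using that by induction (auto intro: subtrees.intros)
  then show "T \<in> subtrees (F \<union> G)" if "T \<in> subtrees F \<union> subtrees G" for T
    using that by (metis Un_iff sup_commute)
qed

lemma subtrees_Node: "subtrees {Node r ts} = insert (Node r ts) (subtrees (fset ts))"
proof (intro equalityI subsetI)
  fix T assume "T \<in> subtrees {Node r ts}"
  then show "T \<in> insert (Node r ts) (subtrees (fset ts))"
    by induction (auto intro: subtrees.intros)
next
  have "T \<in> subtrees {Node r ts}" if "T \<in> subtrees (fset ts)" for T
    using that by induction (auto intro: subtrees.intros)
  then show "T \<in> subtrees {Node r ts}" if "T \<in> insert (Node r ts) (subtrees (fset ts))" for T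
    using that by (auto intro: subtrees.intros)
qed

text \<open>Every subtree of \<open>G\<close> has its root among the vertices of \<open>G\<close>,
  so none of them is rooted at \<open>v\<close>.\<close>

lemma descendants_Un:
  assumes "v \<notin> (\<Union>T\<in>G. verts T)"
  shows "descendants (F \<union> G) v = descendants F v"
proof -
  have "root T \<noteq> v" if "T \<in> subtrees G" for T
    using verts_subtrees[OF that] assms root_in_verts[of T] by blast
  then show ?thesis by (auto simp: descendants_def subtrees_Un)
qed

text \<open>A product over vertices, unlike one over the multiset \<open>hook_lengths F\<close>, can
  be split along disjoint vertex sets.\<close>

definition hook_weight :: "(nat \<Rightarrow> 'b::comm_monoid_mult) \<Rightarrow> 'a rtree set \<Rightarrow> 'b" where
  "hook_weight w F = (\<Prod>v\<in>(\<Union>T\<in>F. verts T). w (hook_length F v))"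

lemma prod_mset_hook_lengths: "(\<Prod>h\<in>#hook_lengths F. w h) = hook_weight w F"
  by (simp add: hook_lengths_def hook_weight_def prod_unfold_prod_mset multiset.map_comp comp_def)

lemma hook_weight_Un:
  assumes "finite (\<Union>T\<in>F. verts T)" "finite (\<Union>T\<in>G. verts T)"
    and "(\<Union>T\<in>F. verts T) \<inter> (\<Union>T\<in>G. verts T) = {}"
  shows "hook_weight w (F \<union> G) = hook_weight w F * hook_weight w G"
proof -
  have "hook_length (F \<union> G) v = hook_length F v" if "v \<in> (\<Union>T\<in>F. verts T)" for v
  proof -
    have "v \<notin> (\<Union>T\<in>G. verts T)" using that assms(3) by blast
    from descendants_Un[OF this] show ?thesis by (simp only: hook_length_def)
  qed
  moreover have "hook_length (F \<union> G) v = hook_length G v" if "v \<in> (\<Union>T\<in>G. verts T)" for v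
  proof -
    have "v \<notin> (\<Union>T\<in>F. verts T)" using that assms(3) by blast
    from descendants_Un[OF this] show ?thesis by (simp only: hook_length_def Un_commute[of F G])
  qed
  ultimately show ?thesis
    unfolding hook_weight_def UN_Un
    by (simp only: prod.union_disjoint[OF assms] cong: prod.cong)
qed

text \<open>As \<open>r\<close> does not occur below, the whole tree is the only subtree rooted at
  \<open>r\<close>, so the hook of \<open>r\<close> is everything. The other vertices keep their
  descendants when the root is removed.\<close>

lemma hook_weight_Node:
  assumes "finite (\<Union>T\<in>fset ts. verts T)" and r: "r \<notin> (\<Union>T\<in>fset ts. verts T)"
  shows "hook_weight w {Node r ts} = w (card (verts (Node r ts))) * hook_weight w (fset ts)"
proof -
  have "root T \<noteq> r" if "T \<in> subtrees (fset ts)" for T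
    using verts_subtrees[OF that] r root_in_verts[of T] by blast
  then have "{T \<in> subtrees {Node r ts}. root T = r} = {Node r ts}"
    by (auto simp: subtrees_Node)
  then have "descendants {Node r ts} r = verts (Node r ts)"
    by (simp add: descendants_def)
  moreover have "descendants {Node r ts} v = descendants (fset ts) v" if "v \<noteq> r" for v
    using that by (auto simp: descendants_def subtrees_Node)
  then have "hook_length {Node r ts} v = hook_length (fset ts) v"
    if "v \<in> (\<Union>T\<in>fset ts. verts T)" for v
    using that r unfolding hook_length_def by metis
  then have "(\<Prod>v\<in>(\<Union>T\<in>fset ts. verts T). w (hook_length {Node r ts} v)) = hook_weight w (fset ts)"
    unfolding hook_weight_def by (intro prod.cong refl) simp
  ultimately show ?thesis
    using assms by (simp add: hook_weight_def[of w "{Node r ts}"] hook_length_def)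
qed

section \<open>Recurrences for the total weights of trees and forests\<close>

lemma sum_hook_weight_trees_on:
  fixes w :: "nat \<Rightarrow> 'b::comm_semiring_1"
  assumes A: "finite A"
  shows "(\<Sum>T\<in>trees_on A. hook_weight w {T}) =
    (\<Sum>r\<in>A. w (card A) * (\<Sum>F\<in>forests_on (A - {r}). hook_weight w F))"
proof -
  have "(\<Sum>T\<in>trees_on A. hook_weight w {T}) =
      (\<Sum>(r, F)\<in>(SIGMA r:A. forests_on (A - {r})). hook_weight w {Node r (Abs_fset F)})"
    by (subst sum.reindex_bij_betw[OF bij_betw_trees_on[OF A], symmetric])
      (simp add: case_prod_unfold)
  also have "\<dots> = (\<Sum>(r, F)\<in>(SIGMA r:A. forests_on (A - {r})). w (card A) * hook_weight w F)"
  proof (intro sum.cong refl, safe)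
    fix r F assume *: "r \<in> A" "F \<in> forests_on (A - {r})"
    have F: "finite F" using finite_forest[OF _ *(2)] A by simp
    have un: "(\<Union>T\<in>F. verts T) = A - {r}" using * by (simp add: forests_on_def)
    have "verts (Node r (Abs_fset F)) = A"
      using F un * by (auto simp: Abs_fset_inverse)
    moreover have "hook_weight w {Node r (Abs_fset F)} =
        w (card (verts (Node r (Abs_fset F)))) * hook_weight w F"
      using F un A by (subst hook_weight_Node) (auto simp: Abs_fset_inverse)
    ultimately show "hook_weight w {Node r (Abs_fset F)} = w (card A) * hook_weight w F"
      by simp
  qed
  also have "\<dots> = (\<Sum>r\<in>A. w (card A) * (\<Sum>F\<in>forests_on (A - {r}). hook_weight w F))"
    using A by (subst sum.Sigma[symmetric]) (auto simp: finite_forests_on sum_distrib_left)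
  finally show ?thesis .
qed

lemma sum_hook_weight_forests_on:
  fixes w :: "nat \<Rightarrow> 'b::comm_semiring_1"
  assumes A: "finite A" and m: "m \<in> A"
  shows "(\<Sum>F\<in>forests_on A. hook_weight w F) =
    (\<Sum>B\<in>Pow (A - {m}). (\<Sum>T\<in>trees_on (insert m B). hook_weight w {T}) *
      (\<Sum>F\<in>forests_on (A - insert m B). hook_weight w F))"
proof -
  let ?S = "SIGMA B:Pow (A - {m}). trees_on (insert m B) \<times> forests_on (A - insert m B)"
  have fin: "finite (insert m B)" if "B \<subseteq> A - {m}" for B
    using that A finite_subset by fastforce
  have "(\<Sum>F\<in>forests_on A. hook_weight w F) = (\<Sum>(B, T, F)\<in>?S. hook_weight w (insert T F))"
    by (subst sum.reindex_bij_betw[OF bij_betw_forests_on[OF m], symmetric])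
      (simp add: case_prod_unfold)
  also have "\<dots> = (\<Sum>(B, T, F)\<in>?S. hook_weight w {T} * hook_weight w F)"
  proof (intro sum.cong refl, safe)
    fix B T F assume *: "B \<subseteq> A - {m}" "T \<in> trees_on (insert m B)" "F \<in> forests_on (A - insert m B)"
    then have "verts T = insert m B" "(\<Union>t\<in>F. verts t) = A - insert m B"
      by (simp_all add: trees_on_def forests_on_def)
    then show "hook_weight w (insert T F) = hook_weight w {T} * hook_weight w F"
      using hook_weight_Un[of "{T}" F w] fin[OF *(1)] A by auto
  qed
  also have "\<dots> = (\<Sum>B\<in>Pow (A - {m}).
      \<Sum>(T, F)\<in>trees_on (insert m B) \<times> forests_on (A - insert m B).
        hook_weight w {T} * hook_weight w F)"
    using A fin
    by (subst sum.Sigma) (auto intro!: finite_trees_on finite_forests_on simp: case_prod_unfold)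
  also have "\<dots> = (\<Sum>B\<in>Pow (A - {m}). (\<Sum>T\<in>trees_on (insert m B). hook_weight w {T}) *
      (\<Sum>F\<in>forests_on (A - insert m B). hook_weight w F))"
    by (simp add: sum_product sum.cartesian_product)
  finally show ?thesis .
qed

lemma sum_Pow_card:
  fixes \<phi> :: "nat \<Rightarrow> 'b::comm_semiring_1"
  assumes "finite A"
  shows "(\<Sum>B\<in>Pow A. \<phi> (card B)) = (\<Sum>k\<le>card A. of_nat (card A choose k) * \<phi> k)"
proof -
  have "(\<Sum>B\<in>Pow A. \<phi> (card B)) = (\<Sum>k\<le>card A. \<Sum>B\<in>{B \<in> Pow A. card B = k}. \<phi> (card B))"
    using assms by (intro sum.group[symmetric]) (auto intro: card_mono)
  also have "\<dots> = (\<Sum>k\<le>card A. of_nat (card {B. B \<subseteq> A \<and> card B = k}) * \<phi> k)"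
    by simp
  finally show ?thesis using assms by (simp add: n_subsets)
qed

text \<open>Both recurrences are merged into the one for \<open>S\<close>: the bracket
  \<open>of_nat (Suc k) * w (Suc k) * S k\<close> stands for the trees on \<open>k + 1\<close>
  labels. Induction over proper subsets also shows that the totals depend only on the number of
  labels.\<close>

lemma sum_hook_weight_eqI:
  fixes w S :: "nat \<Rightarrow> 'b::comm_semiring_1"
  assumes S0: "S 0 = 1"
    and S: "\<And>n. S (Suc n) =
      (\<Sum>k\<le>n. of_nat (n choose k) * (of_nat (Suc k) * w (Suc k) * S k) * S (n - k))"
    and "finite A"
  shows "(\<Sum>F\<in>forests_on A. hook_weight w F) = S (card A)"
  using \<open>finite A\<close>
proof (induction A rule: finite_psubset_induct)
  case (psubset A)
  show ?case
  proof (cases "A = {}")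
    case True
    then show ?thesis by (simp add: forests_on_empty hook_weight_def S0)
  next
    case False
    then obtain m where m: "m \<in> A" by blast
    define n where "n = card (A - {m})"
    have A: "finite A" "card A = Suc n"
      using psubset.hyps card.remove[OF psubset.hyps m] unfolding n_def by auto
    let ?T = "\<lambda>k. of_nat (Suc k) * w (Suc k) * S k"
    have "(\<Sum>F\<in>forests_on A. hook_weight w F) =
        (\<Sum>B\<in>Pow (A - {m}). ?T (card B) * S (n - card B))"
      unfolding sum_hook_weight_forests_on[OF A(1) m]
    proof (rule sum.cong)
      fix B assume "B \<in> Pow (A - {m})"
      then have B: "B \<subseteq> A - {m}" by simp
      have finB: "finite B" using B A finite_subset by fastforce
      have cardB: "card (insert m B) = Suc (card B)" using B finB by (subst card_insert_disjoint) auto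
      have "(\<Sum>T\<in>trees_on (insert m B). hook_weight w {T}) =
          (\<Sum>r\<in>insert m B. w (Suc (card B)) * S (card B))"
        unfolding sum_hook_weight_trees_on[OF finite.insertI[OF finB]] cardB
      proof (rule sum.cong)
        fix r assume r: "r \<in> insert m B"
        have "insert m B - {r} \<subset> A" using r B m by blast
        from psubset.IH[OF this]
        show "w (Suc (card B)) * (\<Sum>F\<in>forests_on (insert m B - {r}). hook_weight w F) =
            w (Suc (card B)) * S (card B)"
          using r finB cardB by simp
      qed simp
      \<comment> \<open>All \<open>card B + 1\<close> choices of the root contribute the same
        amount.\<close>
      also have "\<dots> = ?T (card B)"
        using cardB by (simp only: sum_constant mult.assoc)
      finally have T: "(\<Sum>T\<in>trees_on (insert m B). hook_weight w {T}) = ?T (card B)" .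
      have "A - insert m B \<subset> A" using m by blast
      from psubset.IH[OF this]
      have "(\<Sum>F\<in>forests_on (A - insert m B). hook_weight w F) = S (card (A - insert m B))" .
      also have "card (A - insert m B) = n - card B"
        using card_Diff_subset[of "insert m B" A] finB B m cardB A by auto
      finally show "(\<Sum>T\<in>trees_on (insert m B). hook_weight w {T}) *
          (\<Sum>F\<in>forests_on (A - insert m B). hook_weight w F) = ?T (card B) * S (n - card B)"
        using T by simp
    qed simp
    also have "\<dots> = (\<Sum>k\<le>n. of_nat (n choose k) * (?T k * S (n - k)))"
      using A(1) unfolding n_def by (intro sum_Pow_card) simp
    also have "\<dots> = S (card A)"
      by (simp only: A S mult.assoc)
    finally show ?thesis .
  qed
qed

section \<open>The hook length formula\<close>

lemma ext_prod_of_nat: "ext_prod (int n) c = (\<Prod>i<n. c (int (Suc i)))"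
proof -
  have "(\<Prod>i=1..int n. c i) = (\<Prod>i<n. c (int (Suc i)))"
    by (rule prod.reindex_bij_witness[of _ "\<lambda>i. int (Suc i)" "\<lambda>i. nat (i - 1)"]) auto
  then show ?thesis by (simp add: ext_prod_def)
qed

text \<open>The denominator stays an \<open>ext_prod\<close>, because for \<open>k = 0\<close> its
  upper bound is the exceptional value -1.\<close>

lemma rho_Suc:
  fixes a z :: "'a::field_char_0"
  shows "of_nat (Suc k) * rho a z (Suc k) =
    (\<Prod>i<k. a * of_nat (Suc k) - (a - 1) * of_nat (Suc i)) /
    ext_prod (int k - 1) (\<lambda>i. a * (of_nat k + z) - (a - 1) * of_int i)"
proof -
  have "of_nat (Suc k) * (x / (of_nat (Suc k) * y)) = x / y" for x y :: 'a
    by (simp del: of_nat_Suc)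
  moreover have "int (Suc k) - 1 = int k" "int (Suc k) - 2 = int k - 1"
    "(of_nat (Suc k) :: 'a) - 1 + z = of_nat k + z"
    by simp_all
  ultimately show ?thesis
    unfolding rho_def by (simp only: ext_prod_of_nat of_int_of_nat_eq)
qed

text \<open>The factors in the denominators are
  \<open>a * (k + z) - (a - 1) * i = a * (k - i + z) + i\<close> with \<open>i \<le> k\<close>;
  assumption \<open>nz\<close> makes them nonzero.\<close>

context
  fixes a z :: "'a::field_char_0" and g :: "'a fps"
  assumes g0: "fps_nth g 0 = 0"
    and g: "g = fps_X * fps_const (a - 1) * one_plus_power g (a / (a - 1))"
    and a: "a \<noteq> 1"
    and nz: "\<And>j i. a * (of_nat j + z) + of_nat i \<noteq> 0"
begin

text \<open>The scaled formula is taken at \<open>t = z * a\<close>, where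
  \<open>a * (n + 1) + t = a * (n + 1 + z)\<close>.\<close>

lemma power_za_nth_Suc:
  "fact (Suc n) * fps_nth (one_plus_power g (z * a / (a - 1))) (Suc n) =
    z * a * ext_prod (int n) (\<lambda>i. a * (of_nat (Suc n) + z) - (a - 1) * of_int i)"
proof -
  have "z * a + of_nat (Suc k) \<noteq> 0" for k
    using nz[of 0 "Suc k"] by (simp add: mult_ac)
  from one_plus_power_solution_scaled_nth[OF g0 g a this, of n] show ?thesis
    by (simp add: ext_prod_of_nat algebra_simps)
qed

text \<open>
  So \<open>(k + 1) * rho (k + 1)\<close> is the quotient of the \<open>k\<close>-th coefficients of \<open>f' / f\<close> and \<open>f\<close>.
\<close>

lemma rho_mult_power_za_nth:
  "of_nat (Suc k) * rho a z (Suc k) *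
      (fact k * fps_nth (one_plus_power g (z * a / (a - 1))) k) =
    z * a / (a - 1) * (fact k * fps_nth (fps_deriv g * one_plus_power g (-1)) k)"
proof (cases k)
  \<comment> \<open>By the convention for -1, \<open>rho a z 1\<close> is
    \<open>1 / (1 / (a * z)) = z * a\<close>.\<close>
  case 0
  then show ?thesis
    using a log_deriv_solution_nth[OF g0 g a, of 0]
    by (simp add: rho_def ext_prod_def mult_ac)
next
  case (Suc m)
  let ?E = "ext_prod (int m) (\<lambda>i. a * (of_nat k + z) - (a - 1) * of_int i)"
  have "a * (of_nat k + z) - (a - 1) * of_int (int (Suc i)) \<noteq> 0" if "i < m" for i
  proof -
    have k: "k = (m - i) + Suc i" using that Suc by simp
    have "a * (of_nat k + z) - (a - 1) * of_int (int (Suc i)) =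
        a * (of_nat (m - i) + z) + of_nat (Suc i)"
      by (subst k) (simp only: of_nat_add of_int_of_nat_eq, simp add: algebra_simps)
    then show ?thesis using nz by (simp only: not_False_eq_True)
  qed
  then have "?E \<noteq> 0" by (simp add: ext_prod_of_nat)
  \<comment> \<open>The coefficient of \<open>f\<close> carries exactly the product
    \<open>?E\<close> that is the denominator of \<open>rho\<close>, so it cancels.\<close>
  moreover have "fact k * fps_nth (one_plus_power g (z * a / (a - 1))) k = z * a * ?E"
    unfolding Suc by (rule power_za_nth_Suc)
  ultimately show ?thesis
    unfolding rho_Suc log_deriv_solution_nth[OF g0 g a] using a Suc by simp
qed

text \<open>Replacing each tree term by the coefficient of \<open>f' / f\<close> turns the required
  recurrence into the convolution for \<open>f' = (f' / f) * f\<close>.\<close>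

lemma sum_hook_weight_rho:
  assumes "finite A"
  shows "(\<Sum>F\<in>forests_on A. hook_weight (rho a z) F) =
    fact (card A) * fps_nth (one_plus_power g (z * a / (a - 1))) (card A)"
proof (rule sum_hook_weight_eqI[where
      S = "\<lambda>n. fact n * fps_nth (one_plus_power g (z * a / (a - 1))) n"])
  show "fact (Suc n) * fps_nth (one_plus_power g (z * a / (a - 1))) (Suc n) =
      (\<Sum>k\<le>n. of_nat (n choose k) * (of_nat (Suc k) * rho a z (Suc k) *
        (fact k * fps_nth (one_plus_power g (z * a / (a - 1))) k)) *
        (fact (n - k) * fps_nth (one_plus_power g (z * a / (a - 1))) (n - k)))" for n
    by (simp only: rho_mult_power_za_nth one_plus_power_nth_Suc_convolution[OF g0])
qed (use assms in simp_all)

end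

lemma of_nat_eq_to_fract: "(of_nat n :: 'a::idom fract) = to_fract (of_nat n)"
  by (induction n) simp_all

theorem theorem4p6:
  fixes a z :: "rat poly poly fract" and g f :: "rat poly poly fract fps"
  assumes "a = to_fract [:[:0, 1:]:]" and "z = to_fract [:0, 1:]"
    and "fps_nth g 0 = 0"
    and "g = fps_X * fps_const (a - 1) * one_plus_power g (a / (a - 1))"
    and "f = one_plus_power g (z * a / (a - 1))"
  shows "1 + Abs_fps (\<lambda>n. if n = 0 then 0
             else (\<Sum>F\<in>labeled_forests n. \<Prod>h\<in>#hook_lengths F. rho a z h) / fact n) = f
    \<and> (\<forall>n\<ge>1. (\<Sum>F\<in>labeled_forests n. \<Prod>h\<in>#hook_lengths F. rho a z h)
           = z * a * ext_prod (int n - 1) (\<lambda>i. a * (of_nat n + z) - (a - 1) * of_int i))"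
proof -
  have "a - 1 = to_fract ([:[:0, 1:]:] - 1)"
    unfolding assms(1) by (simp only: to_fract_diff to_fract_1)
  then have a: "a \<noteq> 1"
    by (auto simp: one_pCons)
  have nz: "a * (of_nat j + z) + of_nat i \<noteq> 0" for i j
  proof -
    have "a * (of_nat j + z) + of_nat i =
        to_fract ([:[:0, 1:]:] * (of_nat j + [:0, 1:]) + of_nat i)"
      unfolding assms(1,2) of_nat_eq_to_fract by (simp only: to_fract_add to_fract_mult)
    \<comment> \<open>The outer polynomial variable is \<open>z\<close> and the inner one is
      \<open>a\<close>; the coefficient of \<open>z\<close> is \<open>a\<close>, which is
      nonzero.\<close>
    moreover have "[:[:0, 1:]:] * (of_nat j + [:0, 1:]) + of_nat i \<noteq> (0 :: rat poly poly)"
      by (simp add: of_nat_poly)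
    ultimately show ?thesis by (simp only: to_fract_eq_0_iff not_False_eq_True)
  qed
  have sum: "(\<Sum>F\<in>labeled_forests n. \<Prod>h\<in>#hook_lengths F. rho a z h) = fact n * fps_nth f n" for n
    using sum_hook_weight_rho[OF assms(3,4) a nz, of "{1..n}"]
    by (simp add: prod_mset_hook_lengths labeled_forests_def forests_on_def assms(5))
  show ?thesis
  proof (intro conjI allI impI)
    show "1 + Abs_fps (\<lambda>n. if n = 0 then 0
        else (\<Sum>F\<in>labeled_forests n. \<Prod>h\<in>#hook_lengths F. rho a z h) / fact n) = f"
      \<comment> \<open>The factorials cancel, and the separate summand 1 matches the constant term
        of \<open>f\<close>.\<close>
      unfolding sum by (rule fps_ext) (simp add: assms(5))
  next
    fix n :: nat assume "n \<ge> 1"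
    then obtain m where n: "n = Suc m" by (cases n) auto
    show "(\<Sum>F\<in>labeled_forests n. \<Prod>h\<in>#hook_lengths F. rho a z h) =
        z * a * ext_prod (int n - 1) (\<lambda>i. a * (of_nat n + z) - (a - 1) * of_int i)"
      unfolding sum n assms(5) power_za_nth_Suc[OF assms(3,4) a nz] by simp
  qed
qed

end
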